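(* Directional completeness is not preserved under symmetrization.
   Context: A quasi-modular pseudometric on a nonempty set $X$ is a family $w=\{w_t\}_{t>0}$ of maps $w_t:X\times X\to[0,\infty]$, written $w(x,y,t):=w_t(x,y)$, such that: $w(x,x,t)=0$ for all $x\in X$, $t>0$; $w(x,z,t+s)\le w(x,y,t)+w(y,z,s)$ for all $x,y,z\in X$ and $s,t>0$; and $t\mapsto w(x,y,t)$ is right-continuous and nonincreasing for all $x,y$. The pair $(X,w)$ is a quasi-modular pseudometric space. Its symmetrization is $w^{\mathrm{sym}}(x,y,t):=\max\{w(x,y,t),w(y,x,t)\}$, and $\mathcal U(w^{\mathrm{sym}})$ is the uniformity on $X$ generated by the entourages $\{(x,y): w(x,y,t)<r \text{ and } w(y,x,t)<r\}$ for $r\in(0,1)$, $t>0$. A net $(x_i)_{i\in I}$ in $X$ is forward convergent to $x\in X$ if for every $r\in(0,1)$ and $t>0$ there is $i_0\in I$ with $w(x_i,x,t)<r$ for all $i\ge i_0$; it is backward convergent to $x$ if for every $r\in(0,1)$ and $t>0$ there is $i_0$ with $w(x,x_i,t)<r$ for all $i\ge i_0$. A net $(x_i)$ is forward Cauchy if for every $r\in(0,1)$ and $t>0$ there is $i_0$ with $w(x_i,x_j,t)<r$ for all $j\ge i\ge i_0$; it is backward Cauchy if for every $r\in(0,1)$ and $t>0$ there is $i_0$ with $w(x_j,x_i,t)<r$ for all $j\ge i\ge i_0$. $(X,w)$ is forward complete if every forward Cauchy net is forward convergent (to some point of $X$), and backward complete if every backward Cauchy net is backward convergent (to some point of $X$).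 Directional completeness refers to forward completeness and backward completeness. "Not preserved under symmetrization" is meant in the sense that directional completeness is not an invariant of $w^{\mathrm{sym}}$: there is a quasi-modular pseudometric space $(X,w)$ for which the uniform space $(X,\mathcal U(w^{\mathrm{sym}}))$ is complete while $(X,w)$ fails to be backward complete. *)

theory Defs
  imports "HOL-Analysis.Analysis"
begin

section \<open>Quasi-modular pseudometric spaces\<close>

text \<open>
  The space has an explicit carrier \<open>X\<close>; \<open>w x y t\<close> is only constrained for points of \<open>X\<close> and
  \<open>t > 0\<close>, its values elsewhere are irrelevant.
\<close>

definition quasi_modular_pseudometric :: "'a set \<Rightarrow> ('a \<Rightarrow> 'a \<Rightarrow> real \<Rightarrow> ennreal) \<Rightarrow> bool" where
  "quasi_modular_pseudometric X w \<longleftrightarrow>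
     X \<noteq> {} \<and>
     (\<forall>x\<in>X. \<forall>t>0. w x x t = 0) \<and>
     (\<forall>x\<in>X. \<forall>y\<in>X. \<forall>z\<in>X. \<forall>t>0. \<forall>s>0. w x z (t + s) \<le> w x y t + w y z s) \<and>
     (\<forall>x\<in>X. \<forall>y\<in>X. \<forall>t>0. continuous (at_right t) (w x y)) \<and>
     (\<forall>x\<in>X. \<forall>y\<in>X. antimono_on {0<..} (w x y))"

definition symmetrization ::
    "('a \<Rightarrow> 'a \<Rightarrow> real \<Rightarrow> ennreal) \<Rightarrow> 'a \<Rightarrow> 'a \<Rightarrow> real \<Rightarrow> ennreal" where
  "symmetrization w x y t = max (w x y t) (w y x t)"


section \<open>The uniformity of the symmetrization\<close>

text \<open>
  As for the type class \<^class>\<open>uniform_space\<close>, a uniformity is represented by the filter of its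
  entourages, here subsets of \<open>X \<times> X\<close>. The filter below is a uniformity on \<open>X\<close> when \<open>d\<close> is a
  symmetric quasi-modular pseudometric; it is used for \<open>d = symmetrization w\<close>.
\<close>

definition modular_uniformity :: "'a set \<Rightarrow> ('a \<Rightarrow> 'a \<Rightarrow> real \<Rightarrow> ennreal) \<Rightarrow> ('a \<times> 'a) filter" where
  "modular_uniformity X d =
     (INF (r, t)\<in>{0<..<1} \<times> {0<..}. principal {(x, y). x \<in> X \<and> y \<in> X \<and> d x y t < ennreal r})"

lemma modular_uniformity_symmetrization:
  "modular_uniformity X (symmetrization w) =
     (INF (r, t)\<in>{0<..<1} \<times> {0<..}.
        principal {(x, y). x \<in> X \<and> y \<in> X \<and> w x y t < ennreal r \<and> w y x t < ennreal r})"
  by (simp add: modular_uniformity_def symmetrization_def)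

text \<open>
  The type class constant \<^const>\<open>complete\<close> refers to the single uniformity attached to a type.
  This is the same notion for a uniformity given as a filter on \<open>X \<times> X\<close>: every proper Cauchy
  filter on \<open>X\<close> converges to a point of \<open>X\<close>.
\<close>

definition complete_uniformity_on :: "'a set \<Rightarrow> ('a \<times> 'a) filter \<Rightarrow> bool" where
  "complete_uniformity_on X U \<longleftrightarrow>
     (\<forall>F. F \<noteq> bot \<and> F \<le> principal X \<and> F \<times>\<^sub>F F \<le> U \<longrightarrow>
        (\<exists>x\<in>X. \<forall>E. eventually E U \<longrightarrow> eventually (\<lambda>y. E (x, y)) F))"

lemma complete_uniformity_on_iff_complete:
  fixes S :: "'a::uniform_space set"
  shows "complete_uniformity_on S (inf uniformity (principal (S \<times> S))) \<longleftrightarrow> complete S"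
proof -
  have cauchy: "F \<times>\<^sub>F F \<le> inf uniformity (principal (S \<times> S)) \<longleftrightarrow> cauchy_filter F"
    if "F \<le> principal S" for F :: "'a filter"
  proof -
    have "F \<times>\<^sub>F F \<le> principal (S \<times> S)"
      using prod_filter_mono[OF that that] by (simp add: principal_prod_principal)
    then show ?thesis by (simp add: cauchy_filter_def)
  qed
  have conv: "(\<forall>E. eventually E (inf uniformity (principal (S \<times> S))) \<longrightarrow>
        eventually (\<lambda>y. E (x, y)) F) \<longleftrightarrow> F \<le> nhds x"
    if "F \<le> principal S" "x \<in> S" for F :: "'a filter" and x
  proof
    assume L: "\<forall>E. eventually E (inf uniformity (principal (S \<times> S))) \<longrightarrow>
        eventually (\<lambda>y. E (x, y)) F"
    show "F \<le> nhds x"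
    proof (rule filter_leI)
      fix P assume "eventually P (nhds x)"
      then have "eventually (\<lambda>(x', y). x' = x \<longrightarrow> P y) uniformity"
        by (simp add: eventually_nhds_uniformity)
      then have "eventually (\<lambda>(x', y). x' = x \<longrightarrow> P y) (inf uniformity (principal (S \<times> S)))"
        by (rule filter_leD[OF inf_le1])
      with L have "eventually (\<lambda>y. (\<lambda>(x', y). x' = x \<longrightarrow> P y) (x, y)) F" by blast
      then show "eventually P F" by simp
    qed
  next
    assume R: "F \<le> nhds x"
    show "\<forall>E. eventually E (inf uniformity (principal (S \<times> S))) \<longrightarrow>
        eventually (\<lambda>y. E (x, y)) F"
    proof (intro allI impI)
      fix E assume "eventually E (inf uniformity (principal (S \<times> S)))"
      then have "eventually (\<lambda>p. p \<in> S \<times> S \<longrightarrow> E p) uniformity"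
        by (simp add: eventually_inf_principal)
      then have "eventually (\<lambda>(x', y). x' = x \<longrightarrow> y \<in> S \<longrightarrow> E (x, y)) uniformity"
        by (rule eventually_mono) (use that in auto)
      then have "eventually (\<lambda>y. y \<in> S \<longrightarrow> E (x, y)) (nhds x)"
        by (simp add: eventually_nhds_uniformity)
      then have "eventually (\<lambda>y. y \<in> S \<longrightarrow> E (x, y)) F"
        by (rule filter_leD[OF R])
      moreover have "eventually (\<lambda>y. y \<in> S) F"
        using that(1) by (simp add: le_principal)
      ultimately show "eventually (\<lambda>y. E (x, y)) F"
        by eventually_elim simp
    qed
  qed
  show ?thesis
    unfolding complete_uniformity_on_def complete_uniform
  proof (intro iffI allI impI)
    fix F :: "'a filter"
    assume *: "\<forall>F. F \<noteq> bot \<and> F \<le> principal S \<and> F \<times>\<^sub>F F \<le> inf uniformity (principal (S \<times> S)) \<longrightarrow>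
        (\<exists>x\<in>S. \<forall>E. eventually E (inf uniformity (principal (S \<times> S))) \<longrightarrow>
          eventually (\<lambda>y. E (x, y)) F)"
      and F: "F \<le> principal S" "F \<noteq> bot" "cauchy_filter F"
    then show "\<exists>x\<in>S. F \<le> nhds x"
      using *[rule_format, of F] cauchy[OF F(1)] conv[OF F(1)] by blast
  next
    fix F :: "'a filter"
    assume *: "\<forall>F\<le>principal S. F \<noteq> bot \<longrightarrow> cauchy_filter F \<longrightarrow> (\<exists>x\<in>S. F \<le> nhds x)"
      and F: "F \<noteq> bot \<and> F \<le> principal S \<and> F \<times>\<^sub>F F \<le> inf uniformity (principal (S \<times> S))"
    then obtain x where x: "x \<in> S" "F \<le> nhds x"
      using cauchy by blast
    with conv[of F x] F
    show "\<exists>x\<in>S. \<forall>E. eventually E (inf uniformity (principal (S \<times> S))) \<longrightarrow>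
        eventually (\<lambda>y. E (x, y)) F"
      by blast
  qed
qed


section \<open>Nets and backward completeness\<close>

definition directed_set :: "'i set \<Rightarrow> ('i \<Rightarrow> 'i \<Rightarrow> bool) \<Rightarrow> bool" where
  "directed_set I le \<longleftrightarrow>
     I \<noteq> {} \<and> reflp_on I le \<and> transp_on I le \<and>
     (\<forall>i\<in>I. \<forall>j\<in>I. \<exists>k\<in>I. le i k \<and> le j k)"

definition net_in :: "'a set \<Rightarrow> 'i set \<Rightarrow> ('i \<Rightarrow> 'i \<Rightarrow> bool) \<Rightarrow> ('i \<Rightarrow> 'a) \<Rightarrow> bool" where
  "net_in X I le x \<longleftrightarrow> directed_set I le \<and> (\<forall>i\<in>I. x i \<in> X)"

definition backward_convergent ::
    "('a \<Rightarrow> 'a \<Rightarrow> real \<Rightarrow> ennreal) \<Rightarrow> 'i set \<Rightarrow> ('i \<Rightarrow> 'i \<Rightarrow> bool) \<Rightarrow> ('i \<Rightarrow> 'a) \<Rightarrow> 'a \<Rightarrow> bool" where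
  "backward_convergent w I le x y \<longleftrightarrow>
     (\<forall>r\<in>{0<..<1}. \<forall>t>0. \<exists>i0\<in>I. \<forall>i\<in>I. le i0 i \<longrightarrow> w y (x i) t < ennreal r)"

definition backward_Cauchy ::
    "('a \<Rightarrow> 'a \<Rightarrow> real \<Rightarrow> ennreal) \<Rightarrow> 'i set \<Rightarrow> ('i \<Rightarrow> 'i \<Rightarrow> bool) \<Rightarrow> ('i \<Rightarrow> 'a) \<Rightarrow> bool" where
  "backward_Cauchy w I le x \<longleftrightarrow>
     (\<forall>r\<in>{0<..<1}. \<forall>t>0. \<exists>i0\<in>I. \<forall>i\<in>I. \<forall>j\<in>I.
        le i0 i \<longrightarrow> le i j \<longrightarrow> w (x j) (x i) t < ennreal r)"

text \<open>
  HOL cannot quantify over the types of index sets inside a definition. The index type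
  \<open>('a + nat) list\<close> is large enough for this to be no restriction: by the lemma
  \<open>backward_complete_all_nets\<close> below, the definition covers nets over arbitrary directed sets.
\<close>

definition backward_complete :: "'a set \<Rightarrow> ('a \<Rightarrow> 'a \<Rightarrow> real \<Rightarrow> ennreal) \<Rightarrow> bool" where
  "backward_complete X w \<longleftrightarrow>
     (\<forall>(I :: ('a + nat) list set) le x.
        net_in X I le x \<longrightarrow> backward_Cauchy w I le x \<longrightarrow>
        (\<exists>y\<in>X. backward_convergent w I le x y))"

text \<open>
  Proof idea: a Cauchy net without a limit restricts to a Cauchy net without a limit on any
  directed subset that contains Cauchy indices for \<open>r = t = 1/(n+2)\<close> and, for each point
  \<open>y\<close>, is closed under a function producing larger indices at which convergence to \<open>y\<close> fails.
  Such a subset is enumerated by the following terms.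
\<close>

datatype 'a net_term = Start nat | Join "'a net_term" "'a net_term" | Bad 'a "'a net_term"

primrec encode :: "'a net_term \<Rightarrow> ('a + nat) list" where
  "encode (Start n) = [Inr (Suc n)]"
| "encode (Join a b) = Inr 0 # encode a @ encode b"
| "encode (Bad y a) = Inl y # encode a"

lemma encode_append_inject: "encode a @ u = encode b @ v \<Longrightarrow> a = b \<and> u = v"
proof (induction a arbitrary: b u v)
  case (Start n)
  then show ?case by (cases b) auto
next
  case (Join a1 a2)
  obtain b1 b2 where b: "b = Join b1 b2"
    using Join.prems by (cases b) auto
  then have "encode a1 @ (encode a2 @ u) = encode b1 @ (encode b2 @ v)"
    using Join.prems by simp
  then have "a1 = b1" "encode a2 @ u = encode b2 @ v"
    using Join.IH(1) by blast+
  then show ?case using Join.IH(2) b by blast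
next
  case (Bad y a)
  obtain b' where b: "b = Bad y b'" and "encode a @ u = encode b' @ v"
    using Bad.prems by (cases b) auto
  then show ?case using Bad.IH by blast
qed

lemma inj_encode: "inj encode"
proof (rule injI)
  fix a b :: "'a net_term"
  assume "encode a = encode b"
  then have "encode a @ [] = encode b @ []" by simp
  then show "a = b" by (rule encode_append_inject[THEN conjunct1])
qed

primrec eval_term ::
    "(nat \<Rightarrow> 'i) \<Rightarrow> ('i \<Rightarrow> 'i \<Rightarrow> 'i) \<Rightarrow> ('a \<Rightarrow> 'i \<Rightarrow> 'i) \<Rightarrow> 'a net_term \<Rightarrow> 'i" where
  "eval_term s u b (Start n) = s n"
| "eval_term s u b (Join p q) = u (eval_term s u b p) (eval_term s u b q)"
| "eval_term s u b (Bad y p) = b y (eval_term s u b p)"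

lemma backward_complete_all_nets:
  fixes I :: "'i set"
  assumes w: "quasi_modular_pseudometric X w" and compl: "backward_complete X w"
    and net: "net_in X I le x" and Cauchy: "backward_Cauchy w I le x"
  shows "\<exists>y\<in>X. backward_convergent w I le x y"
proof (rule ccontr)
  assume no: "\<not> ?thesis"
  have refl: "le i i" if "i \<in> I" for i
    using net that by (auto simp: net_in_def directed_set_def reflp_on_def)
  have trans: "le i k" if "le i j" "le j k" "i \<in> I" "j \<in> I" "k \<in> I" for i j k
    using net that by (auto simp: net_in_def directed_set_def dest: transp_onD)
  have anti: "w a b t \<le> w a b s" if "a \<in> X" "b \<in> X" "0 < s" "s \<le> t" for a b s t
    using w that by (auto simp: quasi_modular_pseudometric_def monotone_on_def)
  have xX: "x i \<in> X" if "i \<in> I" for i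
    using net that by (simp add: net_in_def)
  define e where "e n = 1 / (real n + 2)" for n
  have e: "0 < e n" "e n < 1" for n
    by (auto simp: e_def)
  have "\<exists>i0\<in>I. \<forall>i\<in>I. \<forall>j\<in>I. le i0 i \<longrightarrow> le i j \<longrightarrow> w (x j) (x i) (e n) < ennreal (e n)" for n
    using Cauchy e[of n] by (auto simp: backward_Cauchy_def)
  then obtain s where s: "\<And>n. s n \<in> I"
    "\<And>n i j. i \<in> I \<Longrightarrow> j \<in> I \<Longrightarrow> le (s n) i \<Longrightarrow> le i j \<Longrightarrow> w (x j) (x i) (e n) < ennreal (e n)"
    by metis
  have "\<exists>k. k \<in> I \<and> le i k \<and> le j k" if "i \<in> I" "j \<in> I" for i j
    using net that by (auto simp: net_in_def directed_set_def)
  then obtain u where u: "\<And>i j. i \<in> I \<Longrightarrow> j \<in> I \<Longrightarrow> u i j \<in> I \<and> le i (u i j) \<and> le j (u i j)"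
    by metis
  have "\<exists>r t. r \<in> {0<..<1} \<and> 0 < t \<and>
      (\<forall>i0\<in>I. \<exists>i\<in>I. le i0 i \<and> \<not> w y (x i) t < ennreal r)" if "y \<in> X" for y
  proof -
    from no that have "\<not> backward_convergent w I le x y" by blast
    then show ?thesis unfolding backward_convergent_def by blast
  qed
  then obtain R T where RT: "\<And>y. y \<in> X \<Longrightarrow> R y \<in> {0<..<1} \<and> 0 < T y \<and>
      (\<forall>i0\<in>I. \<exists>i\<in>I. le i0 i \<and> \<not> w y (x i) (T y) < ennreal (R y))"
    by metis
  have "\<exists>i\<in>I. y \<in> X \<longrightarrow> le i0 i \<and> \<not> w y (x i) (T y) < ennreal (R y)" if "i0 \<in> I" for y i0
    using RT that by metis
  then have "\<forall>y. \<forall>i0\<in>I. \<exists>i. i \<in> I \<and>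
      (y \<in> X \<longrightarrow> le i0 i \<and> \<not> w y (x i) (T y) < ennreal (R y))"
    by blast
  then obtain b where b: "\<forall>y. \<forall>i0\<in>I. b y i0 \<in> I \<and>
      (y \<in> X \<longrightarrow> le i0 (b y i0) \<and> \<not> w y (x (b y i0)) (T y) < ennreal (R y))"
    unfolding bchoice_iff choice_iff by blast
  define ev where "ev = eval_term s u b"
  have evI: "ev p \<in> I" for p
    by (induction p) (auto simp: ev_def s u b)
  define f where "f l = ev (inv encode l)" for l :: "('a + nat) list"
  have f: "f (encode p) = ev p" for p
    by (simp add: f_def inj_encode)
  have fI: "f l \<in> I" for l
    by (simp add: f_def evI)
  have net': "net_in X UNIV (\<lambda>l m. le (f l) (f m)) (\<lambda>l. x (f l))"
    unfolding net_in_def directed_set_def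
  proof (intro conjI ballI)
    show "reflp_on UNIV (\<lambda>l m. le (f l) (f m))"
      by (simp add: reflp_on_def refl fI)
    show "transp_on UNIV (\<lambda>l m. le (f l) (f m))"
      using trans fI by (intro transp_onI) blast
    fix l m :: "('a + nat) list"
    show "x (f l) \<in> X" by (simp add: xX fI)
    have "f (encode (Join (inv encode l) (inv encode m))) = u (f l) (f m)"
      unfolding f by (simp add: ev_def f_def)
    then show "\<exists>k\<in>UNIV. le (f l) (f k) \<and> le (f m) (f k)"
      using u[OF fI fI] by (metis UNIV_I)
  qed simp
  moreover have "backward_Cauchy w UNIV (\<lambda>l m. le (f l) (f m)) (\<lambda>l. x (f l))"
    unfolding backward_Cauchy_def
  proof (intro ballI allI impI)
    fix r t :: real assume r: "r \<in> {0<..<1}" and t: "0 < t"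
    obtain n where "inverse (real (Suc n)) < min r t"
      using reals_Archimedean[of "min r t"] r t by auto
    moreover have "e n \<le> inverse (real (Suc n))"
      by (simp add: e_def field_simps)
    ultimately have n: "e n < r" "e n < t" by auto
    show "\<exists>l0\<in>UNIV. \<forall>l\<in>UNIV. \<forall>m\<in>UNIV. le (f l0) (f l) \<longrightarrow> le (f l) (f m) \<longrightarrow>
        w (x (f m)) (x (f l)) t < ennreal r"
    proof (intro bexI[of _ "encode (Start n)"] ballI impI)
      fix l m assume "le (f (encode (Start n))) (f l)" and "le (f l) (f m)"
      then have "w (x (f m)) (x (f l)) (e n) < ennreal (e n)"
        using s(2)[OF fI fI] unfolding f by (simp add: ev_def)
      moreover have "w (x (f m)) (x (f l)) t \<le> w (x (f m)) (x (f l)) (e n)"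
        using anti[OF xX[OF fI] xX[OF fI] e(1)] n by simp
      moreover have "ennreal (e n) \<le> ennreal r"
        using n by (intro ennreal_leI) simp
      ultimately show "w (x (f m)) (x (f l)) t < ennreal r"
        by (metis le_less_trans less_le_trans)
    qed simp
  qed
  ultimately obtain y where y: "y \<in> X"
      "backward_convergent w UNIV (\<lambda>l m. le (f l) (f m)) (\<lambda>l. x (f l)) y"
    using compl unfolding backward_complete_def by blast
  then obtain l0 where l0: "\<And>l. le (f l0) (f l) \<Longrightarrow> w y (x (f l)) (T y) < ennreal (R y)"
    using RT[OF y(1)] unfolding backward_convergent_def by blast
  have "f (encode (Bad y (inv encode l0))) = b y (f l0)"
    unfolding f by (simp add: ev_def f_def)
  then show False
    using l0 b[rule_format, OF fI, of y l0] y(1) by metis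
qed

end

theory Submission
  imports Defs
begin

text \<open>
  On the natural numbers let moving downwards be free and moving upwards cost \<open>1\<close>. The
  symmetrization is the discrete metric, which is complete. The sequence \<open>0, 1, 2, \<dots>\<close> is backward
  Cauchy, because it costs nothing to move from a later term to an earlier one, but a backward
  limit would have to be an upper bound of all its terms.
\<close>

definition ascent_cost :: "'a::linorder \<Rightarrow> 'a \<Rightarrow> real \<Rightarrow> ennreal" where
  "ascent_cost x y t = (if y \<le> x then 0 else 1)"

text \<open>Only the costs 0 and 1 occur, so the choice of \<open>r\<close> and \<open>t\<close>
  does not matter: every smallness condition becomes one on the order.\<close>

lemma ascent_cost_less_iff:
  assumes "0 < r" "r < 1"
  shows "ascent_cost x y t < ennreal r \<longleftrightarrow> y \<le> x"
proof -
  have "\<not> 1 < ennreal r"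
    using assms by (metis ennreal_1 ennreal_leI less_imp_le not_le)
  then show ?thesis
    using assms by (simp add: ascent_cost_def)
qed

lemma quasi_modular_pseudometric_ascent_cost:
  assumes "X \<noteq> {}"
  shows "quasi_modular_pseudometric X ascent_cost"
proof -
  have "continuous (at_right t) (ascent_cost x y)" for x y :: 'a and t
    unfolding ascent_cost_def by simp
  \<comment> \<open>If x < z, then x < y or y < z, so one of the two steps already costs 1.\<close>
  moreover have "ascent_cost x z (t + s) \<le> ascent_cost x y t + ascent_cost y z s"
    for x y z :: 'a and t s
    by (auto simp: ascent_cost_def)
  moreover have "antimono_on {0<..} (ascent_cost x y)" for x y :: 'a
    by (simp add: ascent_cost_def monotone_on_def)
  ultimately show ?thesis
    using assms by (simp add: quasi_modular_pseudometric_def ascent_cost_def)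
qed

text \<open>Since the diagonal is an entourage, a Cauchy filter has large sets \<open>P\<close> and
  \<open>Q\<close> whose product lies in it. Any point of \<open>P\<close> is then the only possible
  point of \<open>Q\<close>, so the filter concentrates there.\<close>

lemma complete_uniformity_on_discrete:
  assumes diag: "\<And>x. x \<in> X \<Longrightarrow> principal {(x, x)} \<le> U"
    and discrete: "eventually (\<lambda>(x, y). x = y) U"
  shows "complete_uniformity_on X U"
  unfolding complete_uniformity_on_def
proof (intro allI impI, elim conjE)
  fix F :: "'a filter"
  assume F: "F \<noteq> bot" "F \<le> principal X" "F \<times>\<^sub>F F \<le> U"
  from filter_leD[OF F(3) discrete] obtain P Q where
    PQ: "eventually P F" "eventually Q F" "\<And>x y. P x \<Longrightarrow> Q y \<Longrightarrow> x = y"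
    by (auto simp: eventually_prod_filter)
  have "eventually (\<lambda>x. P x \<and> x \<in> X) F"
    using PQ(1) F(2) by (auto simp: le_principal intro: eventually_conj)
  then obtain x where x: "P x" "x \<in> X"
    using eventually_happens'[OF F(1)] by blast
  have eq: "eventually (\<lambda>y. y = x) F"
    using PQ(2) by eventually_elim (use PQ(3) x in auto)
  show "\<exists>x\<in>X. \<forall>E. eventually E U \<longrightarrow> eventually (\<lambda>y. E (x, y)) F"
  proof (intro bexI[OF _ x(2)] allI impI)
    fix E assume "eventually E U"
    then have "E (x, x)"
      using filter_leD[OF diag[OF x(2)]] by (auto simp: eventually_principal)
    then show "eventually (\<lambda>y. E (x, y)) F"
      using eq by (auto elim: eventually_mono)
  qed
qed

lemma complete_symmetrization_ascent_cost:
  "complete_uniformity_on X (modular_uniformity X (symmetrization ascent_cost))"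
proof (rule complete_uniformity_on_discrete)
  fix x assume "x \<in> X"
  then show "principal {(x, x)} \<le> modular_uniformity X (symmetrization ascent_cost)"
    unfolding modular_uniformity_symmetrization
    by (intro INF_greatest) (auto simp: ascent_cost_less_iff)
next
  \<comment> \<open>A single basic entourage suffices: by antisymmetry of the order it is already
    the diagonal of \<open>X\<close>.\<close>
  have "modular_uniformity X (symmetrization ascent_cost) \<le>
      principal {(x, y). x \<in> X \<and> y \<in> X \<and>
        ascent_cost x y 1 < ennreal (1/2) \<and> ascent_cost y x 1 < ennreal (1/2)}"
    unfolding modular_uniformity_symmetrization
    by (rule INF_lower2[of "(1/2, 1)"]) auto
  also have "\<dots> = principal {(x, y). x \<in> X \<and> y \<in> X \<and> y \<le> x \<and> x \<le> y}"
    by (subst (1 2) ascent_cost_less_iff) simp_all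
  finally show "eventually (\<lambda>(x, y). x = y) (modular_uniformity X (symmetrization ascent_cost))"
    by (rule filter_leD) (auto simp: eventually_principal)
qed

text \<open>
  The index type is fixed to lists by \<^const>\<open>backward_complete\<close>; preordering them by length turns
  the sequence of all natural numbers into the net \<^const>\<open>length\<close>.
\<close>

lemma not_backward_complete_ascent_cost:
  "\<not> backward_complete (UNIV :: nat set) ascent_cost"
proof
  let ?le = "\<lambda>l m :: (nat + nat) list. length l \<le> length m"
  assume "backward_complete (UNIV :: nat set) ascent_cost"
  moreover have "net_in UNIV UNIV ?le length"
    unfolding net_in_def directed_set_def
  proof (intro conjI ballI)
    fix l m :: "(nat + nat) list"
    show "\<exists>k\<in>UNIV. ?le l k \<and> ?le m k"
      by (intro bexI[of _ "l @ m"]) auto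
  qed (auto simp: reflp_on_def transp_on_def)
  moreover have "backward_Cauchy ascent_cost UNIV ?le length"
    by (simp add: backward_Cauchy_def ascent_cost_less_iff)
  ultimately obtain y where "backward_convergent ascent_cost UNIV ?le length y"
    unfolding backward_complete_def by blast
  moreover have "(1/2 :: real) \<in> {0<..<1}" "(0 :: real) < 1"
    by simp_all
  ultimately obtain l0 :: "(nat + nat) list"
    where "\<And>l. ?le l0 l \<Longrightarrow> ascent_cost y (length l) 1 < ennreal (1/2)"
    unfolding backward_convergent_def by blast
  then have l0: "length l \<le> y" if "?le l0 l" for l
    using ascent_cost_less_iff[of "1/2" y "length l" 1] that by fastforce
  \<comment> \<open>Padding \<open>l0\<close> with \<open>Suc y\<close> entries gives an index
    beyond \<open>l0\<close> whose length exceeds \<open>y\<close>.\<close>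
  show False
    using l0[of "l0 @ replicate (Suc y) (Inl 0)"] by simp
qed

theorem proposition5p5:
  shows "\<exists>(X :: nat set) (w :: nat \<Rightarrow> nat \<Rightarrow> real \<Rightarrow> ennreal).
    quasi_modular_pseudometric X w \<and>
    complete_uniformity_on X (modular_uniformity X (symmetrization w)) \<and>
    \<not> backward_complete X w"
  using quasi_modular_pseudometric_ascent_cost[OF UNIV_not_empty]
    complete_symmetrization_ascent_cost not_backward_complete_ascent_cost
  by blast

end
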